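(* Let $n\ge 6$ be even and let $\mathcal{T}_n$ be the set of the four ribbon $L$-shaped $n$-ominoes described in the context (only translations allowed). A $p\times q$ rectangle ($p,q\ge 1$ integers) admits a signed tiling by $\mathcal{T}_n$ if and only if either both $p$ and $q$ are even and at least one of them is divisible by $n$, or one of $p,q$ is odd and the other is divisible by $n\left(\frac{n}{2}-2\right)$.
   Context: Identify the unit cell $[a,a+1]\times[b,b+1]$ of the square lattice with $(a,b)\in\mathbb{Z}^2$. For $n$ even, $\mathcal{T}_n$ consists of all integer translates of the four polyominoes with cell sets $\{(0,j):0\le j\le n-2\}\cup\{(1,0)\}$, $\{(1,j):0\le j\le n-2\}\cup\{(0,n-2)\}$, $\{(i,0):0\le i\le n-2\}\cup\{(0,1)\}$, and $\{(i,1):0\le i\le n-2\}\cup\{(n-2,0)\}$ (no rotations or reflections other than these). A signed tiling of a region $R$ (a finite set of cells) by a set of tiles is a finite collection of translated tiles, each with weight $+1$ or $-1$, such that for every cell of $R$ the sum of the weights of the tiles containing it is $1$ and for every cell outside $R$ this sum is $0$. *)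

theory Defs
  imports Main "HOL-Library.Multiset"
begin

text \<open>The pair \<open>(a, b)\<close> stands for the unit cell \<open>[a, a+1] \<times> [b, b+1]\<close> of the square lattice.\<close>

type_synonym cell = "int \<times> int"

definition translate :: "int \<times> int \<Rightarrow> cell set \<Rightarrow> cell set" where
  "translate v A = (\<lambda>(a, b). (a + fst v, b + snd v)) ` A"

definition translates :: "cell set set \<Rightarrow> cell set set" where
  "translates P = {translate v A | v A. A \<in> P}"

definition ribbon_L_shapes :: "nat \<Rightarrow> cell set set" where
  "ribbon_L_shapes n =
    {{(0, j) | j. 0 \<le> j \<and> j \<le> int n - 2} \<union> {(1, 0)},
     {(1, j) | j. 0 \<le> j \<and> j \<le> int n - 2} \<union> {(0, int n - 2)},
     {(i, 0) | i. 0 \<le> i \<and> i \<le> int n - 2} \<union> {(0, 1)},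
     {(i, 1) | i. 0 \<le> i \<and> i \<le> int n - 2} \<union> {(int n - 2, 0)}}"

definition ribbon_L_tiles :: "nat \<Rightarrow> cell set set" where
  "ribbon_L_tiles n = translates (ribbon_L_shapes n)"

text \<open>A signed tiling is a finite multiset of weighted tiles, so that the same tile
  may be used several times.\<close>

definition signed_tiling :: "cell set set \<Rightarrow> cell set \<Rightarrow> (cell set \<times> int) multiset \<Rightarrow> bool" where
  "signed_tiling \<T> R M \<longleftrightarrow>
     (\<forall>(T, w) \<in> set_mset M. T \<in> \<T> \<and> (w = 1 \<or> w = -1)) \<and>
     (\<forall>c. (\<Sum>(T, w) \<in># M. if c \<in> T then w else 0) = (if c \<in> R then 1 else 0))"

definition admits_signed_tiling :: "cell set set \<Rightarrow> cell set \<Rightarrow> bool" where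
  "admits_signed_tiling \<T> R \<longleftrightarrow> (\<exists>M. signed_tiling \<T> R M)"

definition rectangle :: "nat \<Rightarrow> nat \<Rightarrow> cell set" where
  "rectangle p q = {0..<int p} \<times> {0..<int q}"

end

theory Submission
  imports Defs "HOL-Library.Poly_Mapping" "HOL-Library.Product_Plus" "HOL-Library.Real_Mod"
begin

text \<open>Encode a cell \<open>(a, b)\<close> as the Laurent monomial \<open>x ^ a * y ^ b\<close>; a region has a signed tiling iff its
  generating function lies in the ideal generated by those of the four tiles. Put \<open>n = 2k + 4\<close> and
  \<open>e = x * y - 1\<close>. In the quotient, \<open>x\<close> and \<open>y\<close> act on \<open>e\<close> as \<open>-1\<close>, the \<open>1 \<times> n\<close> bar equals \<open>- e\<close>, and
  \<open>k * e = 0\<close>; hence a bar of length \<open>n k\<close> vanishes. A \<open>2 \<times> n\<close> rectangle is the union of two tiles.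

  Conversely, the weight \<open>\<omega> ^ (a - b)\<close> with \<open>\<omega>\<close> a primitive \<open>n\<close>-th root of unity vanishes on every tile,
  which forces \<open>n\<close> to divide \<open>p\<close> or \<open>q\<close>. The weight \<open>(-1) ^ (a + b) * ((k + 1) * a + b)\<close> is divisible by
  \<open>k (k + 2)\<close> on every tile and gives the sharper condition when one side is odd.\<close>

section \<open>Geometric sums\<close>

lemma sum_power_add_lessThan:
  "(\<Sum>j<a + b. x ^ j) = (\<Sum>j<a. x ^ j) + x ^ a * (\<Sum>j<b. (x :: 'a::comm_ring_1) ^ j)"
  by (induction b) (simp_all add: power_add algebra_simps)

text \<open>A bar of length \<open>l * m\<close> is cut into \<open>l\<close> translates of a bar of
  length \<open>m\<close>. Stated as divisibility, this passes ideal membership on to all multiples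
  of a length.\<close>

lemma sum_power_dvd:
  fixes y :: "'a::comm_ring_1"
  assumes "m dvd q"
  shows "(\<Sum>j<m. y ^ j) dvd (\<Sum>j<q. y ^ j)"
proof -
  obtain l where q: "q = l * m"
    using assms by (metis dvd_def mult.commute)
  have "(\<Sum>j<l * m. y ^ j) = (\<Sum>i<l. y ^ (i * m)) * (\<Sum>j<m. y ^ j)"
  proof (induction l)
    case (Suc l)
    have "Suc l * m = l * m + m"
      by simp
    then show ?case
      by (simp only: sum_power_add_lessThan Suc) (simp add: algebra_simps)
  qed simp
  then show ?thesis
    by (simp add: q)
qed

text \<open>Here \<open>S\<close> stands for \<open>1 + y + ... + y ^ (n-2)\<close> and
  \<open>P\<close> for \<open>y ^ (n-2)\<close>, and the assumption is the telescoping of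
  \<open>S\<close>. The second identity cuts a 2 by \<open>n\<close> rectangle into the first tile
  and the second tile shifted by \<open>y\<close>.\<close>

lemma geometric_identities:
  fixes x y S P :: "'a::comm_ring_1"
  assumes "y * S = S + y * P - 1"
  shows "(1 + x) * (x * y - 1) = y * (x^2 - P) + (y - 1) * (x + S)"
    and "(1 + x) * (S + y * P) = (x + S) + y * (x * S + P)"
proof -
  have D: "y * S - S - y * P + 1 = 0"
    using assms by simp
  have "y * (x^2 - P) + (y - 1) * (x + S) = (1 + x) * (x * y - 1) + (y * S - S - y * P + 1)"
    by (simp add: algebra_simps power2_eq_square)
  then show "(1 + x) * (x * y - 1) = y * (x^2 - P) + (y - 1) * (x + S)"
    by (simp only: D add_0_right)
  have "(1 + x) * (S + y * P) = (x + S) + y * (x * S + P) - x * (y * S - S - y * P + 1)"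
    by (simp add: algebra_simps)
  then show "(1 + x) * (S + y * P) = (x + S) + y * (x * S + P)"
    by (simp only: D mult_zero_right diff_zero)
qed

lemma alternating_sum: "(\<Sum>j<2*k+3. of_nat j * (- 1) ^ j) = (of_nat k + 1 :: 'a::comm_ring_1)"
proof (induction k)
  case (Suc k)
  have "2 * Suc k + 3 = Suc (Suc (2*k+3))"
    by simp
  then show ?case
    using Suc by (simp only: sum.lessThan_Suc) simp
qed (simp add: numeral_3_eq_3)

section \<open>Relations modulo the tiles\<close>

text \<open>With \<open>n = 2k + 4\<close>, so that \<open>n (n/2 - 2) = (2k + 4) k\<close>, the assumptions \<open>tile1\<close> to \<open>tile4\<close>
  are the generating functions of the four tiles.\<close>

locale ribbon_ideal =
  fixes I :: "'a::comm_ring_1 set" and x y :: 'a and k :: nat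
  assumes diff: "\<And>a b. a \<in> I \<Longrightarrow> b \<in> I \<Longrightarrow> a - b \<in> I"
    and mult: "\<And>r a. a \<in> I \<Longrightarrow> r * a \<in> I"
    and tile1: "x + (\<Sum>j<2*k+3. y ^ j) \<in> I"
    and tile2: "x * (\<Sum>j<2*k+3. y ^ j) + y ^ (2*k+2) \<in> I"
    and tile3: "y + (\<Sum>j<2*k+3. x ^ j) \<in> I"
    and tile4: "y * (\<Sum>j<2*k+3. x ^ j) + x ^ (2*k+2) \<in> I"
begin

lemma zero: "0 \<in> I"
  using diff[OF tile1 tile1] by simp

lemma minus: "a \<in> I \<Longrightarrow> - a \<in> I"
  using diff[OF zero] by simp

lemma add: "a \<in> I \<Longrightarrow> b \<in> I \<Longrightarrow> a + b \<in> I"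
  using diff[OF _ minus] by fastforce

lemma sum: "(\<And>i. i \<in> A \<Longrightarrow> f i \<in> I) \<Longrightarrow> sum f A \<in> I"
  by (induction A rule: infinite_finite_induct) (auto intro: zero add)

lemma dvd: "a \<in> I \<Longrightarrow> a dvd b \<Longrightarrow> b \<in> I"
  by (metis dvd_def mult mult.commute)

lemma y_segment_shift:
  "y * (\<Sum>j<2*k+3. y ^ j) = (\<Sum>j<2*k+3. y ^ j) + y * y ^ (2*k+2) - 1"
proof -
  have "y * y ^ (2*k+2) - 1 = (y - 1) * (\<Sum>j<2*k+3. y ^ j)"
    using power_diff_1_eq[of y "2*k+3"] by (simp add: numeral_3_eq_3)
  then show ?thesis
    by (simp only: left_diff_distrib mult_1 add_diff_eq[symmetric]) simp
qed

lemma y_segment_Suc: "(\<Sum>j<2*k+4. y ^ j) = (\<Sum>j<2*k+3. y ^ j) + y * y ^ (2*k+2)"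
  using sum.lessThan_Suc[of "\<lambda>j. y ^ j" "2*k+3"]
  by (simp only: power_Suc[symmetric]) (simp add: eval_nat_numeral)

text \<open>The first tile multiplied by \<open>x\<close> contains the long column of the second
  tile; subtracting cancels it and leaves one cell of each.\<close>

lemma square_eq: "x^2 - y ^ (2*k+2) \<in> I"
proof -
  have "x^2 - y ^ (2*k+2) = x * (x + (\<Sum>j<2*k+3. y ^ j)) - (x * (\<Sum>j<2*k+3. y ^ j) + y ^ (2*k+2))"
    by (simp add: algebra_simps power2_eq_square)
  then show ?thesis
    by (rule ssubst) (rule diff[OF mult[OF tile1] tile2])
qed

lemma x_commutator: "(1 + x) * (x * y - 1) \<in> I"
proof -
  have "(1 + x) * (x * y - 1) = y * (x^2 - y ^ (2*k+2)) + (y - 1) * (x + (\<Sum>j<2*k+3. y ^ j))"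
    by (rule geometric_identities[OF y_segment_shift])
  then show ?thesis
    by (rule ssubst) (rule add[OF mult[OF square_eq] mult[OF tile1]])
qed

end

text \<open>Exchanging \<open>x\<close> and \<open>y\<close> permutes the four tile relations, so
  each relation also holds in mirrored form, under the prefix \<open>swap\<close>.\<close>

sublocale ribbon_ideal \<subseteq> swap: ribbon_ideal I y x k
  by unfold_locales (fact diff mult tile1 tile2 tile3 tile4)+

context ribbon_ideal
begin

text \<open>Both \<open>x\<close> and \<open>y\<close> act as \<open>-1\<close> on
  \<open>x * y - 1\<close>, so \<open>x * y\<close> fixes it.\<close>

lemma xy_square: "(x * y - 1) * (x * y - 1) \<in> I"
proof -
  have "(x * y - 1) * (x * y - 1) = x * ((1 + y) * (y * x - 1)) - (1 + x) * (x * y - 1)"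
    by (simp add: algebra_simps)
  then show ?thesis
    by (rule ssubst) (rule diff[OF mult[OF swap.x_commutator] x_commutator])
qed

text \<open>The binomial expansion around 1 stops after the linear term, since
  \<open>x * y - 1\<close> squares to zero modulo \<open>I\<close>.\<close>

lemma xy_power: "(x * y) ^ j - 1 - of_nat j * (x * y - 1) \<in> I"
proof (induction j)
  case 0
  show ?case by (simp add: zero)
next
  case (Suc j)
  have "(x * y) ^ Suc j - 1 - of_nat (Suc j) * (x * y - 1) =
      (x * y) * ((x * y) ^ j - 1 - of_nat j * (x * y - 1)) + of_nat j * ((x * y - 1) * (x * y - 1))"
    by (simp add: algebra_simps)
  then show ?case
    by (rule ssubst) (rule add[OF mult[OF Suc] mult[OF xy_square]])
qed

lemma y_power_sign: "(y ^ j - (- 1) ^ j) * (x * y - 1) \<in> I"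
proof (induction j)
  case 0
  show ?case by (simp add: zero)
next
  case (Suc j)
  have "(y ^ Suc j - (- 1) ^ Suc j) * (x * y - 1) =
      y * ((y ^ j - (- 1) ^ j) * (x * y - 1)) + (- 1) ^ j * ((1 + y) * (y * x - 1))"
    by (simp add: algebra_simps)
  then show ?case
    by (rule ssubst) (rule add[OF mult[OF Suc] mult[OF swap.x_commutator]])
qed

text \<open>Modulo \<open>I\<close> the first tile turns the lower \<open>n - 1\<close> cells of the
  bar into \<open>- x\<close>, and the last cell \<open>y ^ (n-1)\<close> becomes
  \<open>x^2 * y\<close>. The bar is therefore \<open>x * (x * y - 1)\<close>, where
  \<open>x\<close> acts as \<open>-1\<close>.\<close>

lemma y_line: "(\<Sum>j<2*k+4. y ^ j) + (x * y - 1) \<in> I"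
proof -
  have "(\<Sum>j<2*k+4. y ^ j) + (x * y - 1) =
      (x + (\<Sum>j<2*k+3. y ^ j)) - y * (x^2 - y ^ (2*k+2)) + (1 + x) * (x * y - 1)"
    unfolding y_segment_Suc by (simp add: algebra_simps power2_eq_square)
  then show ?thesis
    by (rule ssubst) (rule add[OF diff[OF tile1 mult[OF square_eq]] x_commutator])
qed

text \<open>Modulo \<open>I\<close>, \<open>y ^ (n-2) = x\<^sup>2\<close> turns \<open>y ^ (n-2) * (1 + x + \<dots> + x ^ (n-2))\<close> into \<open>- x\<^sup>2 * y\<close>; expanding
  each \<open>x ^ j * y ^ (n-2)\<close> as \<open>(x * y) ^ j * y ^ (n-2-j)\<close> gives a second value, and the two
  differ by \<open>k * (x * y - 1)\<close>.\<close>

lemma k_commutator: "of_nat k * (x * y - 1) \<in> I"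
proof -
  let ?e = "x * y - 1" and ?m = "2*k+2"
  have *: "x ^ j * y ^ ?m - y ^ (?m - j) - of_nat j * (- 1) ^ j * ?e \<in> I" if "j < 2*k+3" for j
  proof -
    have "y ^ ?m = y ^ j * y ^ (?m - j)"
      using that by (simp flip: power_add)
    \<comment> \<open>\<open>?m\<close> is even and \<open>j \<le> ?m\<close>, so
      \<open>?m - j\<close> has the parity of \<open>j\<close>.\<close>
    moreover have "(- 1) ^ (?m - j) = ((- 1) ^ j :: 'a)"
      using that by (auto simp: minus_one_power_iff)
    ultimately have "x ^ j * y ^ ?m - y ^ (?m - j) - of_nat j * (- 1) ^ j * ?e =
        y ^ (?m - j) * ((x * y) ^ j - 1 - of_nat j * ?e) + of_nat j * ((y ^ (?m - j) - (- 1) ^ (?m - j)) * ?e)"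
      by (simp add: algebra_simps power_mult_distrib)
    then show ?thesis
      using add[OF mult[OF xy_power] mult[OF y_power_sign]] by simp
  qed
  have "(\<Sum>j<2*k+3. x ^ j * y ^ ?m - y ^ (?m - j) - of_nat j * (- 1) ^ j * ?e) \<in> I"
    using * by (intro sum) auto
  moreover have "(\<Sum>j<2*k+3. y ^ (?m - j)) = (\<Sum>j<2*k+3. y ^ j)"
    by (subst sum.nat_diff_reindex[symmetric]) (auto intro!: sum.cong)
  ultimately have "(\<Sum>j<2*k+3. x ^ j) * y ^ ?m - (\<Sum>j<2*k+3. y ^ j) - (of_nat k + 1) * ?e \<in> I"
    by (simp only: sum_subtractf flip: sum_distrib_right alternating_sum)
  \<comment> \<open>The tiles and \<open>x^2 = y ^ ?m\<close> reduce the difference of the two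
    segment terms to \<open>x - x^2 * y = - x * ?e\<close>, which is \<open>?e\<close> modulo
    \<open>I\<close>. Comparison with \<open>(k + 1) * ?e\<close> leaves
    \<open>k * ?e\<close>.\<close>
  moreover have "of_nat k * ?e =
      y ^ ?m * (y + (\<Sum>j<2*k+3. x ^ j)) - (x + (\<Sum>j<2*k+3. y ^ j))
      + y * (x^2 - y ^ ?m) - (1 + x) * ?e
      - ((\<Sum>j<2*k+3. x ^ j) * y ^ ?m - (\<Sum>j<2*k+3. y ^ j) - (of_nat k + 1) * ?e)"
    by (simp add: algebra_simps power2_eq_square)
  ultimately show ?thesis
    using diff[OF diff[OF add[OF diff[OF mult[OF tile3] tile1] mult[OF square_eq]] x_commutator]]
    by metis
qed

lemma y_lines: "(\<Sum>j<l*(2*k+4). y ^ j) + of_nat l * (x * y - 1) \<in> I"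
proof (induction l)
  case 0
  show ?case by (simp add: zero)
next
  case (Suc l)
  define N M e where "N = l*(2*k+4)" and "M = 2*k+4" and "e = x * y - 1"
  \<comment> \<open>The offset \<open>N\<close> is even, so shifting by \<open>y ^ N\<close> fixes
    \<open>e\<close> and each further bar contributes the same \<open>- e\<close>.\<close>
  have sign: "(y ^ N - 1) * e \<in> I"
    using y_power_sign[of N] by (simp add: N_def e_def)
  have "(\<Sum>j<N+M. y ^ j) + of_nat (Suc l) * e =
      ((\<Sum>j<N. y ^ j) + of_nat l * e) + y ^ N * ((\<Sum>j<M. y ^ j) + e) - (y ^ N - 1) * e"
    by (simp only: sum_power_add_lessThan) (simp add: algebra_simps)
  also have "\<dots> \<in> I"
    unfolding N_def M_def e_def
    by (rule diff[OF add[OF Suc mult[OF y_line]] sign[unfolded N_def e_def]])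
  finally show ?case
    by (simp add: N_def M_def e_def add.commute)
qed

lemma y_segment:
  assumes "(2*k+4) * k dvd q"
  shows "(\<Sum>j<q. y ^ j) \<in> I"
proof -
  have "(\<Sum>j<(2*k+4)*k. y ^ j) \<in> I"
    using diff[OF y_lines[of k] k_commutator] by (simp add: mult.commute)
  then show ?thesis
    using dvd sum_power_dvd[OF assms] by blast
qed

lemma even_rectangle:
  assumes "2 dvd p" "2*k+4 dvd q"
  shows "(\<Sum>i<p. x ^ i) * (\<Sum>j<q. y ^ j) \<in> I"
proof -
  have two: "(\<Sum>i<2. x ^ i) = 1 + x"
    by (simp add: numeral_2_eq_2)
  have "(\<Sum>i<2. x ^ i) * (\<Sum>j<2*k+4. y ^ j) =
      (x + (\<Sum>j<2*k+3. y ^ j)) + y * (x * (\<Sum>j<2*k+3. y ^ j) + y ^ (2*k+2))"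
    unfolding two y_segment_Suc by (rule geometric_identities[OF y_segment_shift])
  also have "\<dots> \<in> I"
    by (rule add[OF tile1 mult[OF tile2]])
  finally have "(\<Sum>i<2. x ^ i) * (\<Sum>j<2*k+4. y ^ j) \<in> I" .
  moreover have "(\<Sum>i<2. x ^ i) * (\<Sum>j<2*k+4. y ^ j) dvd (\<Sum>i<p. x ^ i) * (\<Sum>j<q. y ^ j)"
    using assms by (intro mult_dvd_mono sum_power_dvd)
  ultimately show ?thesis
    using dvd by blast
qed

end

section \<open>Ribbon L-shaped tiles and weighted sums\<close>

lemma vertical_segment: "{(a, j) | j. 0 \<le> j \<and> j \<le> int (2*k+4) - 2} = (\<lambda>j. (a, int j)) ` {..<2*k+3}"
proof (intro equalityI subsetI)
  fix c assume "c \<in> {(a, j) | j. 0 \<le> j \<and> j \<le> int (2*k+4) - 2}"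
  then show "c \<in> (\<lambda>j. (a, int j)) ` {..<2*k+3}"
    by (intro image_eqI[of _ _ "nat (snd c)"]) auto
qed auto

lemma horizontal_segment: "{(i, b) | i. 0 \<le> i \<and> i \<le> int (2*k+4) - 2} = (\<lambda>i. (int i, b)) ` {..<2*k+3}"
proof (intro equalityI subsetI)
  fix c assume "c \<in> {(i, b) | i. 0 \<le> i \<and> i \<le> int (2*k+4) - 2}"
  then show "c \<in> (\<lambda>i. (int i, b)) ` {..<2*k+3}"
    by (intro image_eqI[of _ _ "nat (fst c)"]) auto
qed auto

lemma ribbon_L_shapes_eq:
  "ribbon_L_shapes (2*k+4) =
    {insert (1, 0) ((\<lambda>j. (0, int j)) ` {..<2*k+3}),
     insert (0, int (2*k+2)) ((\<lambda>j. (1, int j)) ` {..<2*k+3}),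
     insert (0, 1) ((\<lambda>i. (int i, 0)) ` {..<2*k+3}),
     insert (int (2*k+2), 0) ((\<lambda>i. (int i, 1)) ` {..<2*k+3})}"
  unfolding ribbon_L_shapes_def vertical_segment horizontal_segment by (simp add: algebra_simps)

lemma translate_eq_image: "translate v A = (+) v ` A"
  unfolding translate_def by (intro image_cong) (auto simp: prod_eq_iff)

lemma finite_ribbon_L_tile: "T \<in> ribbon_L_tiles (2*k+4) \<Longrightarrow> finite T"
  by (auto simp: ribbon_L_tiles_def translates_def translate_def ribbon_L_shapes_eq)

lemma sum_shape:
  fixes w :: "int \<times> int \<Rightarrow> 'a::comm_monoid_add"
  shows "sum w (insert (1, 0) ((\<lambda>j. (0, int j)) ` {..<2*k+3})) = w (1, 0) + (\<Sum>j<2*k+3. w (0, int j))"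
    and "sum w (insert (0, int (2*k+2)) ((\<lambda>j. (1, int j)) ` {..<2*k+3})) = w (0, int (2*k+2)) + (\<Sum>j<2*k+3. w (1, int j))"
    and "sum w (insert (0, 1) ((\<lambda>i. (int i, 0)) ` {..<2*k+3})) = w (0, 1) + (\<Sum>i<2*k+3. w (int i, 0))"
    and "sum w (insert (int (2*k+2), 0) ((\<lambda>i. (int i, 1)) ` {..<2*k+3})) = w (int (2*k+2), 0) + (\<Sum>i<2*k+3. w (int i, 1))"
  by (subst sum.insert; force simp: sum.reindex inj_on_def)+

lemma sum_translate: "sum w (translate v A) = (\<Sum>c\<in>A. w (v + c))"
  unfolding translate_eq_image by (simp add: sum.reindex)

lemma sum_rectangle: "sum w (rectangle p q) = (\<Sum>i<p. \<Sum>j<q. w (int i, int j))"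
proof -
  have "{0..<int m} = int ` {..<m}" for m
    by (metis image_int_atLeastLessThan lessThan_atLeast0 of_nat_0)
  then have "sum w (rectangle p q) = (\<Sum>a\<in>int ` {..<p}. \<Sum>b\<in>int ` {..<q}. w (a, b))"
    by (simp add: rectangle_def sum.cartesian_product)
  then show ?thesis
    by (simp add: sum.reindex)
qed

text \<open>Double counting: the sum over cells is exchanged with the sum over tiles.
  \<open>U\<close> is a finite window containing all tiles, which keeps the sum over cells
  finite.\<close>

lemma signed_sum_mset_eq:
  fixes w :: "cell \<Rightarrow> 'a::comm_ring_1"
  assumes "finite U" and "\<And>T s. (T, s) \<in># M \<Longrightarrow> T \<subseteq> U"
  shows "(\<Sum>c\<in>U. of_int (\<Sum>(T, s)\<in>#M. if c \<in> T then s else 0) * w c) = (\<Sum>(T, s)\<in>#M. of_int s * sum w T)"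
  using assms(2)
proof (induction M)
  case (add X M)
  obtain T s where X: "X = (T, s)"
    by fastforce
  have "(\<Sum>c\<in>U. of_int (if c \<in> T then s else 0) * w c) = (\<Sum>c\<in>U. if c \<in> T then of_int s * w c else 0)"
    by (intro sum.cong) auto
  also have "\<dots> = of_int s * sum w T"
    using add.prems[of T s] \<open>finite U\<close>
    by (simp add: X sum_distrib_left Int_absorb1 flip: sum.inter_restrict)
  finally have "(\<Sum>c\<in>U. of_int (if c \<in> T then s else 0) * w c) = of_int s * sum w T" .
  moreover have "(\<Sum>c\<in>U. of_int (\<Sum>(T, s)\<in>#M. if c \<in> T then s else 0) * w c) = (\<Sum>(T, s)\<in>#M. of_int s * sum w T)"
    using add.prems by (intro add.IH) auto
  ultimately show ?case
    by (simp add: X distrib_right sum.distrib)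
qed simp

text \<open>Any cell weight extends linearly to signed tilings. Every obstruction below is an
  instance of this.\<close>

lemma sum_signed_tiling:
  fixes w :: "cell \<Rightarrow> 'a::comm_ring_1"
  assumes "signed_tiling \<T> R M" and "finite R" and "\<And>T. T \<in> \<T> \<Longrightarrow> finite T"
  shows "sum w R = (\<Sum>(T, s)\<in>#M. of_int s * sum w T)"
proof -
  define U where "U = R \<union> \<Union> (fst ` set_mset M)"
  have tiles: "T \<in> \<T>" if "(T, s) \<in># M" for T s
    using assms(1) that by (auto simp: signed_tiling_def)
  have U: "finite U"
    using assms(2,3) tiles by (auto simp: U_def)
  have "(\<Sum>c\<in>U. of_int (\<Sum>(T, s)\<in>#M. if c \<in> T then s else 0) * w c) = (\<Sum>c\<in>U. of_int (if c \<in> R then 1 else 0) * w c)"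
    using assms(1) unfolding signed_tiling_def by presburger
  also have "\<dots> = (\<Sum>c\<in>U. if c \<in> R then w c else 0)"
    by (intro sum.cong) auto
  also have "\<dots> = sum w (U \<inter> R)"
    using U by (simp add: sum.inter_restrict)
  also have "U \<inter> R = R"
    by (auto simp: U_def)
  finally have "(\<Sum>c\<in>U. of_int (\<Sum>(T, s)\<in>#M. if c \<in> T then s else 0) * w c) = sum w R" .
  moreover have "(\<Sum>c\<in>U. of_int (\<Sum>(T, s)\<in>#M. if c \<in> T then s else 0) * w c) = (\<Sum>(T, s)\<in>#M. of_int s * sum w T)"
    by (rule signed_sum_mset_eq[OF U]) (force simp: U_def)
  ultimately show ?thesis
    by (rule trans[OF sym])
qed

section \<open>The ideal of tileable chains\<close>

text \<open>The type \<open>cell \<Rightarrow>\<^sub>0 int\<close> with convolution is the group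
  ring of the lattice, that is, the ring of integer Laurent polynomials in \<open>x\<close> and
  \<open>y\<close>; \<open>chain A\<close> is the generating function of a finite
  \<open>A\<close>.\<close>

definition chain :: "cell set \<Rightarrow> cell \<Rightarrow>\<^sub>0 int" where
  "chain A = (\<Sum>c\<in>A. Poly_Mapping.single c 1)"

definition tileable_chains :: "cell set set \<Rightarrow> (cell \<Rightarrow>\<^sub>0 int) set" where
  "tileable_chains \<T> = {(\<Sum>(T, s)\<in>#M. of_int s * chain T) | M. \<forall>(T, s) \<in># M. T \<in> \<T> \<and> (s = 1 \<or> s = -1)}"

lemma lookup_chain: "finite A \<Longrightarrow> Poly_Mapping.lookup (chain A) c = (if c \<in> A then 1 else 0)"
  by (induction A rule: finite_induct) (auto simp: chain_def lookup_add lookup_single when_def)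

lemma lookup_signed_sum:
  assumes "\<And>T s. (T, s) \<in># M \<Longrightarrow> finite T"
  shows "Poly_Mapping.lookup (\<Sum>(T, s)\<in>#M. of_int s * chain T) c = (\<Sum>(T, s)\<in>#M. if c \<in> T then s else 0)"
  using assms
proof (induction M)
  case (add X M)
  obtain T s where X: "X = (T, s)"
    by fastforce
  \<comment> \<open>In this ring the integer \<open>s\<close> is a constant polynomial, so
    convolution with it just scales the coefficients.\<close>
  have "of_int s * chain T = Poly_Mapping.map ((*) s) (chain T)"
    by (simp add: mult_map_scale_conv_mult flip: single_of_int)
  then have "Poly_Mapping.lookup (of_int s * chain T) c = (if c \<in> T then s else 0)"
    using add.prems[of T s] by (simp add: X lookup_chain map.rep_eq when_def)
  moreover have "Poly_Mapping.lookup (\<Sum>(T, s)\<in>#M. of_int s * chain T) c = (\<Sum>(T, s)\<in>#M. if c \<in> T then s else 0)"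
    using add.prems by (intro add.IH) auto
  ultimately show ?case
    by (simp add: X lookup_add)
qed simp

lemma admits_if_chain_tileable:
  assumes "chain R \<in> tileable_chains \<T>" "finite R" "\<And>T. T \<in> \<T> \<Longrightarrow> finite T"
  shows "admits_signed_tiling \<T> R"
proof -
  obtain M where M: "chain R = (\<Sum>(T, s)\<in>#M. of_int s * chain T)" "\<forall>(T, s) \<in># M. T \<in> \<T> \<and> (s = 1 \<or> s = -1)"
    using assms(1) by (auto simp: tileable_chains_def)
  have "finite T" if "(T, s) \<in># M" for T s
    using M(2) assms(3) that by auto
  then have "Poly_Mapping.lookup (chain R) c = (\<Sum>(T, s)\<in>#M. if c \<in> T then s else 0)" for c
    unfolding M(1) by (rule lookup_signed_sum)
  then have "(\<Sum>(T, s)\<in>#M. if c \<in> T then s else 0) = (if c \<in> R then 1 else 0)" for c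
    by (metis lookup_chain[OF assms(2)])
  then show ?thesis
    using M(2) by (auto simp: admits_signed_tiling_def signed_tiling_def)
qed

lemma chain_in_tileable: "T \<in> \<T> \<Longrightarrow> chain T \<in> tileable_chains \<T>"
  unfolding tileable_chains_def by (auto intro!: exI[of _ "{#(T, 1)#}"])

lemma tileable_diff:
  assumes "a \<in> tileable_chains \<T>" "b \<in> tileable_chains \<T>"
  shows "a - b \<in> tileable_chains \<T>"
proof -
  obtain M N where MN: "a = (\<Sum>(T, s)\<in>#M. of_int s * chain T)" "\<forall>(T, s) \<in># M. T \<in> \<T> \<and> (s = 1 \<or> s = -1)"
    "b = (\<Sum>(T, s)\<in>#N. of_int s * chain T)" "\<forall>(T, s) \<in># N. T \<in> \<T> \<and> (s = 1 \<or> s = -1)"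
    using assms by (auto simp: tileable_chains_def)
  let ?N = "image_mset (\<lambda>(T, s). (T, - s)) N"
  have "(\<Sum>(T, s)\<in>#?N. of_int s * chain T) = - b"
    unfolding MN(3) by (induction N) auto
  then have "a - b = (\<Sum>(T, s)\<in>#M + ?N. of_int s * chain T)"
    using MN(1) by simp
  moreover have "\<forall>(T, s) \<in># M + ?N. T \<in> \<T> \<and> (s = 1 \<or> s = -1)"
    using MN(2,4) by auto
  ultimately show ?thesis
    unfolding tileable_chains_def by blast
qed

lemma single_mult_chain: "Poly_Mapping.single v 1 * chain A = chain (translate v A)"
  by (simp add: chain_def sum_translate sum_distrib_left mult_single)

lemma translate_in_translates: "A \<in> translates P \<Longrightarrow> translate v A \<in> translates P"
proof -
  have "translate v (translate u B) = translate (v + u) B" for u B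
    by (simp add: translate_eq_image image_image add.assoc)
  then show "A \<in> translates P \<Longrightarrow> translate v A \<in> translates P"
    unfolding translates_def by blast
qed

lemma tileable_single_mult:
  assumes "a \<in> tileable_chains (translates P)"
  shows "Poly_Mapping.single v 1 * a \<in> tileable_chains (translates P)"
proof -
  obtain M where M: "a = (\<Sum>(T, s)\<in>#M. of_int s * chain T)" "\<forall>(T, s) \<in># M. T \<in> translates P \<and> (s = 1 \<or> s = -1)"
    using assms by (auto simp: tileable_chains_def)
  let ?M = "image_mset (\<lambda>(T, s). (translate v T, s)) M"
  have "Poly_Mapping.single v 1 * a = (\<Sum>(T, s)\<in>#?M. of_int s * chain T)"
    unfolding M(1) by (induction M) (auto simp: distrib_left mult.left_commute single_mult_chain)
  moreover have "\<forall>(T, s) \<in># ?M. T \<in> translates P \<and> (s = 1 \<or> s = -1)"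
    using M(2) by (auto intro: translate_in_translates)
  ultimately show ?thesis
    unfolding tileable_chains_def by blast
qed

text \<open>Monomials act by translation and generate the ring additively, so closure under
  differences and translations already gives an ideal.\<close>

lemma tileable_mult:
  assumes "a \<in> tileable_chains (translates P)"
  shows "r * a \<in> tileable_chains (translates P)"
proof (induction r rule: frag_induction[OF subset_UNIV, case_names zero one diff])
  case zero
  show ?case
    using tileable_diff[OF assms assms] by simp
next
  case (one v)
  show ?case
    using tileable_single_mult[OF assms] by simp
next
  case (diff a b)
  then show ?case
    by (simp add: left_diff_distrib tileable_diff)
qed

lemma single_power_fst: "Poly_Mapping.single (1 :: int, 0 :: int) (1 :: int) ^ i = Poly_Mapping.single (int i, 0) 1"
  by (induction i) (simp_all add: mult_single flip: single_one zero_prod_def)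

lemma single_power_snd: "Poly_Mapping.single (0 :: int, 1 :: int) (1 :: int) ^ j = Poly_Mapping.single (0, int j) 1"
  by (induction j) (simp_all add: mult_single flip: single_one zero_prod_def)

lemma chain_rectangle:
  "chain (rectangle p q) =
    (\<Sum>i<p. Poly_Mapping.single (1, 0) 1 ^ i) * (\<Sum>j<q. Poly_Mapping.single (0, 1) 1 ^ j)"
  by (simp add: chain_def sum_rectangle single_power_fst single_power_snd sum_product mult_single)

lemma shape_is_tile: "A \<in> ribbon_L_shapes n \<Longrightarrow> A \<in> ribbon_L_tiles n"
proof -
  have "translate 0 A = A"
    by (simp add: translate_def case_prod_unfold)
  then show "A \<in> ribbon_L_shapes n \<Longrightarrow> A \<in> ribbon_L_tiles n"
    unfolding ribbon_L_tiles_def translates_def by (metis (mono_tags, lifting) mem_Collect_eq)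
qed

lemma ribbon_ideal_tileable_chains:
  "ribbon_ideal (tileable_chains (ribbon_L_tiles (2*k+4))) (Poly_Mapping.single (1, 0) 1) (Poly_Mapping.single (0, 1) 1) k"
proof -
  have shape: "chain A \<in> tileable_chains (ribbon_L_tiles (2*k+4))" if "A \<in> ribbon_L_shapes (2*k+4)" for A
    by (rule chain_in_tileable[OF shape_is_tile[OF that]])
  note shapes = shape[unfolded ribbon_L_shapes_eq]
  show ?thesis
  proof
    show "Poly_Mapping.single (1, 0) 1 + (\<Sum>j<2*k+3. Poly_Mapping.single (0, 1) 1 ^ j) \<in> tileable_chains (ribbon_L_tiles (2*k+4))"
      using shapes[OF insertI1] by (simp only: chain_def sum_shape single_power_snd)
    show "Poly_Mapping.single (1, 0) 1 * (\<Sum>j<2*k+3. Poly_Mapping.single (0, 1) 1 ^ j) + Poly_Mapping.single (0, 1) 1 ^ (2*k+2) \<in> tileable_chains (ribbon_L_tiles (2*k+4))"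
      using shapes[OF insertI2[OF insertI1]]
      by (simp only: chain_def sum_shape single_power_snd sum_distrib_left mult_single) (simp add: add.commute)
    show "Poly_Mapping.single (0, 1) 1 + (\<Sum>i<2*k+3. Poly_Mapping.single (1, 0) 1 ^ i) \<in> tileable_chains (ribbon_L_tiles (2*k+4))"
      using shapes[OF insertI2[OF insertI2[OF insertI1]]] by (simp only: chain_def sum_shape single_power_fst)
    show "Poly_Mapping.single (0, 1) 1 * (\<Sum>i<2*k+3. Poly_Mapping.single (1, 0) 1 ^ i) + Poly_Mapping.single (1, 0) 1 ^ (2*k+2) \<in> tileable_chains (ribbon_L_tiles (2*k+4))"
      using shapes[OF insertI2[OF insertI2[OF insertI2[OF insertI1]]]]
      by (simp only: chain_def sum_shape single_power_fst sum_distrib_left mult_single) (simp add: add.commute)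
  qed (simp_all add: ribbon_L_tiles_def tileable_diff tileable_mult)
qed

lemma finite_rectangle: "finite (rectangle p q)"
  by (simp add: rectangle_def)

lemma rectangle_tileable:
  assumes "(even p \<and> even q \<and> (2*k+4 dvd p \<or> 2*k+4 dvd q)) \<or> (2*k+4) * k dvd q \<or> (2*k+4) * k dvd p"
  shows "admits_signed_tiling (ribbon_L_tiles (2*k+4)) (rectangle p q)"
proof -
  interpret ribbon_ideal "tileable_chains (ribbon_L_tiles (2*k+4))"
    "Poly_Mapping.single (1, 0) 1" "Poly_Mapping.single (0, 1) 1" k
    by (rule ribbon_ideal_tileable_chains)
  have "chain (rectangle p q) \<in> tileable_chains (ribbon_L_tiles (2*k+4))"
    unfolding chain_rectangle
    using assms even_rectangle[of p q] swap.even_rectangle[of q p] y_segment[of q] swap.y_segment[of p]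
    by (metis mult mult.commute)
  then show ?thesis
    by (rule admits_if_chain_tileable[OF _ finite_rectangle finite_ribbon_L_tile])
qed

section \<open>Weights obstructing signed tilings\<close>

text \<open>Divisibility covers both kinds of obstruction: with \<open>d = 0\<close> over the
  complex numbers the weight vanishes, and over the integers it is a congruence modulo
  \<open>d\<close>.\<close>

lemma dvd_weight_of_tileable:
  fixes w :: "cell \<Rightarrow> 'a::comm_ring_1"
  assumes "admits_signed_tiling \<T> R" "finite R" "\<And>T. T \<in> \<T> \<Longrightarrow> finite T"
    and "\<And>T. T \<in> \<T> \<Longrightarrow> d dvd sum w T"
  shows "d dvd sum w R"
proof -
  obtain M where M: "signed_tiling \<T> R M"
    using assms(1) by (auto simp: admits_signed_tiling_def)
  have "\<forall>(T, s) \<in># M. d dvd sum w T"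
    using M assms(4) by (auto simp: signed_tiling_def)
  then have "d dvd (\<Sum>(T, s)\<in>#M. of_int s * sum w T)"
    by (induction M) auto
  then show ?thesis
    by (simp only: sum_signed_tiling[OF M assms(2,3), of w])
qed

lemma dvd_weight_of_rectangle:
  fixes w :: "cell \<Rightarrow> 'a::comm_ring_1"
  assumes "admits_signed_tiling (ribbon_L_tiles (2*k+4)) (rectangle p q)"
    and "\<And>v. d dvd w (v + (1, 0)) + (\<Sum>j<2*k+3. w (v + (0, int j)))"
    and "\<And>v. d dvd w (v + (0, int (2*k+2))) + (\<Sum>j<2*k+3. w (v + (1, int j)))"
    and "\<And>v. d dvd w (v + (0, 1)) + (\<Sum>i<2*k+3. w (v + (int i, 0)))"
    and "\<And>v. d dvd w (v + (int (2*k+2), 0)) + (\<Sum>i<2*k+3. w (v + (int i, 1)))"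
  shows "d dvd (\<Sum>i<p. \<Sum>j<q. w (int i, int j))"
proof -
  have "d dvd sum w T" if T: "T \<in> ribbon_L_tiles (2*k+4)" for T
  proof -
    obtain v A where "T = translate v A" "A \<in> ribbon_L_shapes (2*k+4)"
      using T by (auto simp: ribbon_L_tiles_def translates_def)
    then show ?thesis
      using assms(2-5)[of v]
      by (auto simp only: sum_translate ribbon_L_shapes_eq insert_iff empty_iff sum_shape)
  qed
  then have "d dvd sum w (rectangle p q)"
    by (intro dvd_weight_of_tileable[OF assms(1) finite_rectangle]) (auto intro: finite_ribbon_L_tile)
  then show ?thesis
    by (simp only: sum_rectangle)
qed

text \<open>All \<open>n\<close> powers of \<open>z\<close> sum to zero, and the one left out is
  \<open>z ^ (n-1)\<close>, the inverse of \<open>z\<close>.\<close>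

lemma sum_root_of_unity:
  fixes z :: complex
  assumes "z ^ (2*k+4) = 1" "z \<noteq> 1"
  shows "(\<Sum>j<2*k+3. z ^ j) = - inverse z"
proof -
  have "z \<noteq> 0"
    using assms(1) by (auto simp: power_0_left)
  have "z ^ (2*k+4) = z * z ^ (2*k+3)"
    by (simp add: eval_nat_numeral)
  then have "z ^ (2*k+3) = inverse z"
    using assms(1) by (metis inverse_unique)
  moreover have "z ^ (2*k+3) - 1 = (z - 1) * (\<Sum>j<2*k+3. z ^ j)"
    by (rule power_diff_1_eq)
  moreover have "inverse z - 1 = (z - 1) * (- inverse z)"
    using \<open>z \<noteq> 0\<close> by (simp add: field_simps)
  ultimately show ?thesis
    using assms(2) by (metis mult_cancel_left right_minus_eq)
qed

lemma tileable_root_of_unity: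
  fixes z :: complex
  assumes tiling: "admits_signed_tiling (ribbon_L_tiles (2*k+4)) (rectangle p q)"
    and z: "z ^ (2*k+4) = 1" "z \<noteq> 1"
  shows "z ^ p = 1 \<or> z ^ q = 1"
proof -
  define u where "u = inverse z"
  define w where "w c = z powi fst c * u powi snd c" for c :: cell
  have z0: "z \<noteq> 0"
    using z(1) by (auto simp: power_0_left)
  then have u0: "u \<noteq> 0" and zu: "z * u = 1"
    by (auto simp: u_def)
  have u: "u ^ (2*k+4) = 1" "u \<noteq> 1"
    using z z0 by (auto simp: u_def power_inverse inverse_eq_1_iff simp del: power_Suc)
  \<comment> \<open>The weight is multiplicative, so only the four tiles at the origin have to be
    checked.\<close>
  have add: "w (v + c) = w v * w c" for v c
    using z0 u0 by (simp add: w_def power_int_add)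
  have sums: "(\<Sum>j<2*k+3. z ^ j) = - u" "(\<Sum>j<2*k+3. u ^ j) = - z"
    using sum_root_of_unity[OF z] sum_root_of_unity[OF u] by (simp_all add: u_def)
  \<comment> \<open>The exponent \<open>n - 2\<close> acts as \<open>-2\<close>; this evaluates the
    far single cells of the second and fourth tiles.\<close>
  have "z ^ (2*k+4) = z ^ (2*k+2) * (z * z)" "u ^ (2*k+4) = u ^ (2*k+2) * (u * u)"
    by (simp_all add: eval_nat_numeral)
  then have powers: "z ^ (2*k+2) = u * u" "u ^ (2*k+2) = z * z"
    using z(1) u(1) zu by (metis mult.assoc mult.commute mult_1)+
  have ends: "w (int (2*k+2), 0) = u * u" "w (0, int (2*k+2)) = z * z"
    unfolding w_def fst_conv snd_conv power_int_of_nat powers by simp_all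
  have "0 dvd (\<Sum>i<p. \<Sum>j<q. w (int i, int j))"
  proof (rule dvd_weight_of_rectangle[OF tiling])
    fix v
    show "0 dvd w (v + (1, 0)) + (\<Sum>j<2*k+3. w (v + (0, int j)))"
      unfolding add by (simp add: w_def sums flip: sum_distrib_left)
    show "0 dvd w (v + (0, int (2*k+2))) + (\<Sum>j<2*k+3. w (v + (1, int j)))"
      unfolding add ends by (simp add: w_def sums flip: sum_distrib_left)
    show "0 dvd w (v + (0, 1)) + (\<Sum>i<2*k+3. w (v + (int i, 0)))"
      unfolding add by (simp add: w_def sums flip: sum_distrib_left)
    show "0 dvd w (v + (int (2*k+2), 0)) + (\<Sum>i<2*k+3. w (v + (int i, 1)))"
      unfolding add ends by (simp add: w_def sums flip: sum_distrib_left sum_distrib_right)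
  qed
  then have "(\<Sum>i<p. z ^ i) * (\<Sum>j<q. u ^ j) = 0"
    by (simp add: w_def sum_product)
  then have "z ^ p = 1 \<or> u ^ q = 1"
    using power_diff_1_eq[of z p] power_diff_1_eq[of u q] by auto
  then show ?thesis
    by (auto simp: u_def power_inverse)
qed

lemma tileable_imp_dvd:
  assumes "admits_signed_tiling (ribbon_L_tiles (2*k+4)) (rectangle p q)"
  shows "2*k+4 dvd p \<or> 2*k+4 dvd q"
proof -
  \<comment> \<open>A primitive \<open>n\<close>-th root of unity, so that \<open>?z ^ m = 1\<close>
    forces \<open>n\<close> to divide \<open>m\<close>.\<close>
  let ?z = "cis (2 * pi / real (2*k+4))"
  have dvd: "2*k+4 dvd m" if "?z ^ m = 1" for m
  proof -
    have "cis (real m * (2 * pi / real (2*k+4))) = 1"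
      using that by (simp add: DeMoivre)
    then obtain l where "real m * (2 * pi / real (2*k+4)) = of_int l * (2 * pi)"
      by (auto simp: cis_eq_1_iff)
    then have "(2 * pi) * (real m / real (2*k+4)) = (2 * pi) * of_int l"
      by (simp add: mult.commute del: of_nat_add of_nat_mult)
    then have "real m / real (2*k+4) = of_int l"
      unfolding mult_cancel_left by simp
    then have "real m = of_int l * real (2*k+4)"
      by (simp add: divide_eq_eq del: of_nat_add of_nat_mult)
    then have "int m = l * int (2*k+4)"
      by (metis of_int_eq_iff of_int_mult of_int_of_nat_eq)
    then show ?thesis
      by (metis dvd_triv_right int_dvd_int_iff)
  qed
  have "?z ^ (2*k+4) = 1"
    unfolding DeMoivre by simp
  moreover have "?z \<noteq> 1"
    using dvd[of 1] by auto
  ultimately show ?thesis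
    using tileable_root_of_unity[OF assms] dvd by blast
qed

lemma sum_alternating_even: "(\<Sum>j<2*r. (- 1) ^ j) = (0 :: int)" "(\<Sum>j<2*r. int j * (- 1) ^ j) = - int r"
  by (induction r) simp_all

lemma sum_alternating_odd: "odd m \<Longrightarrow> (\<Sum>j<m. (- 1) ^ j) = (1 :: int)"
  by (auto elim!: oddE simp: sum_alternating_even)

text \<open>Up to sign the weight \<open>w\<close> below is the derivative of the monomial \<open>x ^ a * y ^ b\<close> at \<open>(-1, -1)\<close>
  in the direction \<open>(k + 1, 1)\<close>, along which the derivatives of all four tiles vanish modulo
  \<open>k (k + 2)\<close>.\<close>

lemma tileable_alternating_dvd:
  assumes "admits_signed_tiling (ribbon_L_tiles (2*k+4)) (rectangle p q)"
  shows "int (k * (k+2)) dvd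
    int (k+1) * (\<Sum>i<p. int i * (- 1) ^ i) * (\<Sum>j<q. (- 1) ^ j)
    + (\<Sum>i<p. (- 1) ^ i) * (\<Sum>j<q. int j * (- 1) ^ j)"
proof -
  define s :: "int \<Rightarrow> int" where "s a = (if even a then 1 else - 1)" for a
  define sg where "sg c = s (fst c) * s (snd c)" for c :: cell
  define L where "L c = int (k+1) * fst c + snd c" for c :: cell
  define w where "w c = sg c * L c" for c :: cell
  have s_nat: "s (int j) = (- 1) ^ j" for j
    by (simp add: s_def minus_one_power_iff)
  \<comment> \<open>By this product rule, a translated tile depends only on its sign sum and its
    weight at the origin. The sign sum of each tile is zero, so the position \<open>v\<close>
    contributes only a sign.\<close>
  have add: "w (v + c) = sg v * (L v * sg c + w c)" for v c
    by (simp add: w_def sg_def L_def s_def algebra_simps)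
  have sum_add: "(\<Sum>j\<in>A. w (v + f j)) = sg v * (L v * (\<Sum>j\<in>A. sg (f j)) + (\<Sum>j\<in>A. w (f j)))" for v f and A :: "nat set"
    by (simp add: add sum.distrib flip: sum_distrib_left)
  have alt: "(\<Sum>j<2*k+3. (- 1) ^ j) = (1 :: int)" "(\<Sum>j<2*k+3. int j * (- 1) ^ j) = int k + 1"
    using alternating_sum[of k, where ?'a = int] by (simp_all add: sum_alternating_odd)
  have sg_sums: "(\<Sum>j<2*k+3. sg (0, int j)) = 1" "(\<Sum>j<2*k+3. sg (1, int j)) = - 1"
      "(\<Sum>i<2*k+3. sg (int i, 0)) = 1" "(\<Sum>i<2*k+3. sg (int i, 1)) = - 1"
    by (simp_all add: sg_def s_nat alt s_def[of 0] s_def[of 1] sum_negf)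
  have linear_sum: "(\<Sum>j<2*k+3. (- 1) ^ j * (c * int j + d)) = c * (int k + 1) + d" for c d :: int
  proof -
    have "(\<Sum>j<2*k+3. (- 1) ^ j * (c * int j + d)) =
        c * (\<Sum>j<2*k+3. int j * (- 1) ^ j) + d * (\<Sum>j<2*k+3. (- 1) ^ j)"
      by (simp add: sum_distrib_left sum.distrib algebra_simps)
    then show ?thesis
      by (simp add: alt)
  qed
  have w_values: "w (0, int j) = (- 1) ^ j * (1 * int j + 0)" "w (1, int j) = - ((- 1) ^ j * (1 * int j + (int k + 1)))"
      "w (int j, 0) = (- 1) ^ j * ((int k + 1) * int j + 0)" "w (int j, 1) = - ((- 1) ^ j * ((int k + 1) * int j + 1))" for j
    by (simp_all add: w_def sg_def L_def s_nat s_def[of 0] s_def[of 1] algebra_simps)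
  have w_sums: "(\<Sum>j<2*k+3. w (0, int j)) = int k + 1" "(\<Sum>j<2*k+3. w (1, int j)) = - (2 * (int k + 1))"
      "(\<Sum>i<2*k+3. w (int i, 0)) = (int k + 1)^2" "(\<Sum>i<2*k+3. w (int i, 1)) = - ((int k + 1)^2 + 1)"
    unfolding w_values sum_negf linear_sum by (simp_all add: power2_eq_square algebra_simps)
  have sg_ends: "sg (1, 0) = - 1" "sg (0, int (2*k+2)) = 1" "sg (0, 1) = - 1" "sg (int (2*k+2), 0) = 1"
    by (simp_all add: sg_def s_def)
  have w_ends: "w (1, 0) = - (int k + 1)" "w (0, int (2*k+2)) = 2 * (int k + 1)" "w (0, 1) = - 1"
      "w (int (2*k+2), 0) = 2 * (int k + 1)^2"
    unfolding w_def sg_ends by (simp_all add: L_def power2_eq_square algebra_simps)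
  \<comment> \<open>At the origin the first two tiles have weight 0 and the other two have weight
    \<open>(k + 1)^2 - 1\<close>; this is where the modulus comes from.\<close>
  have k: "(int k + 1)^2 = int (k * (k+2)) + 1"
    by (simp add: power2_eq_square algebra_simps)
  have "int (k * (k+2)) dvd (\<Sum>i<p. \<Sum>j<q. w (int i, int j))"
  proof (rule dvd_weight_of_rectangle[OF assms])
    fix v
    show "int (k * (k+2)) dvd w (v + (1, 0)) + (\<Sum>j<2*k+3. w (v + (0, int j)))"
      unfolding sum_add unfolding add sg_sums w_sums sg_ends w_ends by (simp flip: distrib_left)
    show "int (k * (k+2)) dvd w (v + (0, int (2*k+2))) + (\<Sum>j<2*k+3. w (v + (1, int j)))"
      unfolding sum_add unfolding add sg_sums w_sums sg_ends w_ends by (simp flip: distrib_left)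
    show "int (k * (k+2)) dvd w (v + (0, 1)) + (\<Sum>i<2*k+3. w (v + (int i, 0)))"
      unfolding sum_add unfolding add sg_sums w_sums sg_ends w_ends k by (simp flip: distrib_left)
    show "int (k * (k+2)) dvd w (v + (int (2*k+2), 0)) + (\<Sum>i<2*k+3. w (v + (int i, 1)))"
      unfolding sum_add unfolding add sg_sums w_sums sg_ends w_ends k by (simp flip: distrib_left)
  qed
  moreover have "(\<Sum>j<q. w (int i, int j)) =
      int (k+1) * (int i * (- 1) ^ i) * (\<Sum>j<q. (- 1) ^ j) + (- 1) ^ i * (\<Sum>j<q. int j * (- 1) ^ j)" for i
    by (simp add: w_def sg_def L_def s_nat sum_distrib_left sum.distrib algebra_simps)
  then have "(\<Sum>i<p. \<Sum>j<q. w (int i, int j)) =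
    int (k+1) * (\<Sum>i<p. int i * (- 1) ^ i) * (\<Sum>j<q. (- 1) ^ j)
    + (\<Sum>i<p. (- 1) ^ i) * (\<Sum>j<q. int j * (- 1) ^ j)"
    by (simp only: sum.distrib flip: sum_distrib_left sum_distrib_right)
  ultimately show ?thesis
    by simp
qed

text \<open>For \<open>q = 2 * r\<close> the plain alternating sum over \<open>q\<close> is zero and
  the linear one is \<open>- r\<close>, while odd \<open>p\<close> gives alternating sum 1. Only
  \<open>- r\<close> survives, and \<open>2 * k * (k + 2) = n * k\<close>.\<close>

lemma tileable_odd_width:
  assumes "admits_signed_tiling (ribbon_L_tiles (2*k+4)) (rectangle p q)" "odd p" "even q"
  shows "(2*k+4) * k dvd q"
proof -
  obtain r where q: "q = 2 * r"
    using assms(3) by auto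
  have "int (k * (k+2)) dvd int r"
    using tileable_alternating_dvd[OF assms(1)] assms(2) by (simp add: q sum_alternating_even sum_alternating_odd)
  then have "k * (k+2) dvd r"
    by (simp only: int_dvd_int_iff)
  then have "2 * (k * (k+2)) dvd q"
    unfolding q by (rule mult_dvd_mono[OF dvd_refl])
  then show ?thesis
    by (simp add: algebra_simps)
qed

lemma tileable_odd_height:
  assumes "admits_signed_tiling (ribbon_L_tiles (2*k+4)) (rectangle p q)" "even p" "odd q"
  shows "(2*k+4) * k dvd p"
proof -
  obtain r where p: "p = 2 * r"
    using assms(2) by auto
  have r: "int (k * (k+2)) dvd int (k+1) * int r"
    using tileable_alternating_dvd[OF assms(1)] assms(3) by (simp add: p sum_alternating_even sum_alternating_odd)
  \<comment> \<open>The factor \<open>k + 1\<close> is its own inverse modulo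
    \<open>k * (k + 2)\<close>, so multiplying by it once more isolates \<open>r\<close>.\<close>
  have "int (k * (k+2)) dvd int (k+1) * (int (k+1) * int r) - int (k * (k+2)) * int r"
    by (rule dvd_diff[OF dvd_mult[OF r] dvd_triv_left])
  also have "\<dots> = int r"
    by (simp add: algebra_simps)
  finally have "k * (k+2) dvd r"
    by (simp only: int_dvd_int_iff)
  then have "2 * (k * (k+2)) dvd p"
    unfolding p by (rule mult_dvd_mono[OF dvd_refl])
  then show ?thesis
    by (simp add: algebra_simps)
qed

theorem theorem1:
  fixes n p q :: nat
  assumes "n \<ge> 6" and "even n" and "p \<ge> 1" and "q \<ge> 1"
  shows "admits_signed_tiling (ribbon_L_tiles n) (rectangle p q) \<longleftrightarrow>
    (even p \<and> even q \<and> (n dvd p \<or> n dvd q)) \<or>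
    (odd p \<and> n * (n div 2 - 2) dvd q) \<or>
    (odd q \<and> n * (n div 2 - 2) dvd p)"
proof -
  define k where "k = n div 2 - 2"
  have n: "n = 2*k+4"
    using assms(1,2) by (auto simp: k_def elim!: evenE)
  \<comment> \<open>A tiling forces \<open>n\<close> to divide a side, so the sides of a tileable
    rectangle are not both odd; the remaining parities match the three alternatives.\<close>
  have even: "even p \<or> even q" if "n dvd p \<or> n dvd q"
    using that assms(2) dvd_trans by blast
  show ?thesis
    using tileable_imp_dvd[of k p q] tileable_odd_width[of k p q] tileable_odd_height[of k p q]
      rectangle_tileable[of p q k] even
    unfolding k_def[symmetric] n[symmetric] by blast
qed

end
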